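(* Let $1\le p\le k$. For $\beta\in B=\{0,1\}^p$ let $\psi_\beta$ be the functional defined by $$(\psi_\beta b)(x_1,\ldots,x_k)=\int_{[0,1]^p}\chi_\beta(u_1,\ldots,u_p,x_1,\ldots,x_p)\; b(u_1,\ldots,u_p,x_{p+1},\ldots,x_k)\,du_1\cdots du_p .$$ Then for each $g\in\mathcal{G}_{kp}$, $$g=\sum_{\beta\in B}\psi_\beta\, g^\beta .$$
   Context: $\mathcal{R}_k=[0,1]^k$. $B=\{0,1\}^p$ is the set of all sequences $\beta=(\beta_1,\ldots,\beta_p)$ of zeros and ones, and $|\beta|=\sum_j\beta_j$. For a function $g$ on $\mathcal{R}_k$ and $\beta\in B$, $$g^\beta(x)=\frac{\partial^{|\beta|}g(x)}{\partial x_{i_1}\cdots\partial x_{i_{|\beta|}}},$$ where $i_1<\cdots<i_{|\beta|}$ are the indices $i\in\{1,\ldots,p\}$ with $\beta_i=1$; thus $g^\beta$ is a function on $\mathcal{R}_k$ involving derivatives only in the first $p$ variables. $\mathcal{G}_{kp}$ is the class of bounded functions $g$ on $\mathcal{R}_k$ for which $g^\beta$ is well defined and bounded on $\mathcal{R}_k$ for each $\beta\in B$. The kernels are $$\chi_\beta(u_1,\ldots,u_p,x_1,\ldots,x_p)=\prod_{j=1}^p\chi_{\beta_j}(u_j,x_j),$$ where, for $u,x\in[0,1]$, $\chi_0(u,x)=1$ and $\chi_1(u,x)=u-1+I(u\le x)$, with $I(u\le x)=1$ if $u\le x$ and $0$ otherwise. *)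

theory Defs
  imports "HOL-Analysis.Analysis"
begin

text \<open>
  A point of the $n$-dimensional unit cube is a function on the index set \<open>{1..n}\<close> that is
  \<open>undefined\<close> elsewhere.  A real function on the cube is represented by a function of type
  \<open>(nat \<Rightarrow> real) \<Rightarrow> real\<close>; its values off the cube are irrelevant.
\<close>

definition cube :: "nat \<Rightarrow> (nat \<Rightarrow> real) set" where
  "cube n = ({1..n} \<rightarrow>\<^sub>E {0..1})"

definition Bset :: "nat \<Rightarrow> (nat \<Rightarrow> nat) set" where
  "Bset p = ({1..p} \<rightarrow>\<^sub>E {0, 1})"

text \<open>
  The derivatives are taken within the unit interval, hence are one-sided on the faces of the cube.
  The \<open>vector_derivative\<close> is an arbitrary value where no derivative exists, so existence is
  stated separately in \<open>partials_exist\<close>.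
\<close>

definition partial :: "nat \<Rightarrow> ((nat \<Rightarrow> real) \<Rightarrow> real) \<Rightarrow> (nat \<Rightarrow> real) \<Rightarrow> real" where
  "partial i f x = vector_derivative (\<lambda>t. f (x(i := t))) (at (x i) within {0..1})"

definition partial_exists :: "nat \<Rightarrow> nat \<Rightarrow> ((nat \<Rightarrow> real) \<Rightarrow> real) \<Rightarrow> bool" where
  "partial_exists k i f \<longleftrightarrow>
     (\<forall>x\<in>cube k. (\<lambda>t. f (x(i := t))) differentiable (at (x i) within {0..1}))"

text \<open>
  For a list of indices \<open>[i\<^sub>1, \<dots>, i\<^sub>m]\<close> the iterated partial derivative is
  $\partial_{i_1}(\cdots(\partial_{i_m} f))$, i.e. the last variable is differentiated first.
\<close>

primrec partials :: "nat list \<Rightarrow> ((nat \<Rightarrow> real) \<Rightarrow> real) \<Rightarrow> (nat \<Rightarrow> real) \<Rightarrow> real" where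
  "partials [] f = f"
| "partials (i # is) f = partial i (partials is f)"

primrec partials_exist :: "nat \<Rightarrow> nat list \<Rightarrow> ((nat \<Rightarrow> real) \<Rightarrow> real) \<Rightarrow> bool" where
  "partials_exist k [] f \<longleftrightarrow> True"
| "partials_exist k (i # is) f \<longleftrightarrow>
     partials_exist k is f \<and> partial_exists k i (partials is f)"

definition indices :: "nat \<Rightarrow> (nat \<Rightarrow> nat) \<Rightarrow> nat list" where
  "indices p \<beta> = filter (\<lambda>i. \<beta> i = 1) [1..<Suc p]"

definition mixed :: "nat \<Rightarrow> (nat \<Rightarrow> nat) \<Rightarrow> ((nat \<Rightarrow> real) \<Rightarrow> real) \<Rightarrow> (nat \<Rightarrow> real) \<Rightarrow> real" where
  "mixed p \<beta> g = partials (indices p \<beta>) g"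

definition Gclass :: "nat \<Rightarrow> nat \<Rightarrow> ((nat \<Rightarrow> real) \<Rightarrow> real) set" where
  "Gclass k p = {g. bounded (g ` cube k) \<and>
     (\<forall>\<beta>\<in>Bset p. partials_exist k (indices p \<beta>) g \<and> bounded (mixed p \<beta> g ` cube k))}"

definition chi1 :: "nat \<Rightarrow> real \<Rightarrow> real \<Rightarrow> real" where
  "chi1 b u x = (if b = 0 then 1 else u - 1 + (if u \<le> x then 1 else 0))"

definition chi :: "nat \<Rightarrow> (nat \<Rightarrow> nat) \<Rightarrow> (nat \<Rightarrow> real) \<Rightarrow> (nat \<Rightarrow> real) \<Rightarrow> real" where
  "chi p \<beta> u x = (\<Prod>j=1..p. chi1 (\<beta> j) (u j) (x j))"

text \<open>
  The point \<open>merge {1..p} {p+1..k} (u, x)\<close> is $(u_1,\ldots,u_p,x_{p+1},\ldots,x_k)$.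
\<close>

definition psi_integrand ::
  "nat \<Rightarrow> nat \<Rightarrow> (nat \<Rightarrow> nat) \<Rightarrow> ((nat \<Rightarrow> real) \<Rightarrow> real) \<Rightarrow> (nat \<Rightarrow> real) \<Rightarrow> (nat \<Rightarrow> real) \<Rightarrow> real" where
  "psi_integrand k p \<beta> b x u = chi p \<beta> u x * b (merge {1..p} {p+1..k} (u, x))"

definition psi ::
  "nat \<Rightarrow> nat \<Rightarrow> (nat \<Rightarrow> nat) \<Rightarrow> ((nat \<Rightarrow> real) \<Rightarrow> real) \<Rightarrow> (nat \<Rightarrow> real) \<Rightarrow> real" where
  "psi k p \<beta> b x =
     (LINT u:cube p|(\<Pi>\<^sub>M j\<in>{1..p}. lborel). psi_integrand k p \<beta> b x u)"

text \<open>
  The Bochner integral of a non-integrable function is 0 by convention; this predicate says that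
  the integral defining \<open>psi\<close> genuinely exists.
\<close>

definition psi_defined ::
  "nat \<Rightarrow> nat \<Rightarrow> (nat \<Rightarrow> nat) \<Rightarrow> ((nat \<Rightarrow> real) \<Rightarrow> real) \<Rightarrow> (nat \<Rightarrow> real) \<Rightarrow> bool" where
  "psi_defined k p \<beta> b x \<longleftrightarrow>
     set_integrable (\<Pi>\<^sub>M j\<in>{1..p}. lborel) (cube p) (psi_integrand k p \<beta> b x)"

end

theory Submission
  imports Defs
begin

text \<open>
  In one variable the identity reads
  $f(x) = \int_0^1 f(u)\,du + \int_0^1 (u - 1 + I(u \le x))\,f'(u)\,du$.  It is the sum of two
  instances of the fundamental theorem of calculus: the integral of
  $((u-1)f(u))' = f(u) + (u-1)f'(u)$ over $[0,1]$ is $f(0)$, and the integral of $f'$ over $[0,x]$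
  is $f(x) - f(0)$.  The derivative is only known to exist everywhere and to be bounded, so the
  theorem has to be used in its Henstock-Kurzweil form, which agrees with the Lebesgue integral
  because $f'$ is bounded and Borel (\<open>one_variable_representation\<close>).

  The general case is an iteration over the variables.  Expand $g$ in the variable $x_p$; the two
  functions $g$ and $\partial_p g$ that appear belong to the class for $p-1$ variables, so each of
  them is expanded in the remaining ones.  This order is forced: in $g^\beta$ the variable with the
  largest index is differentiated first, so that $g^\beta$ is a mixed derivative in the first $p-1$
  variables of $g$ or of $\partial_p g$, and no interchange of derivatives is ever needed
  (\<open>sum_psi_mixed\<close>).

  Fubini's theorem turns the iterated integrals into integrals over the cube, and it needs every
  $g^\beta$ to be jointly measurable in $u_1, \dots, u_p$.  Measurability is not assumed; it follows
  from the derivatives.  Bounded partial derivatives make $g$ Lipschitz in each of the first $p$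
  variables, hence jointly continuous in them (\<open>slice_measurable_Gclass\<close>), and a partial
  derivative of a Borel function is a pointwise limit of Borel difference quotients
  (\<open>slice_measurable_partial\<close>).
\<close>

section \<open>Points of the cube and iterated derivatives\<close>

lemma cube_nth: "x \<in> cube k \<Longrightarrow> i \<in> {1..k} \<Longrightarrow> 0 \<le> x i \<and> x i \<le> 1"
  by (auto simp: cube_def PiE_iff)

lemma fun_upd_in_cube:
  assumes "x \<in> cube k" "i \<in> {1..k}" "t \<in> {0..1}"
  shows "x(i := t) \<in> cube k"
  using assms by (auto simp: cube_def PiE_iff extensional_def)

lemma partials_append: "partials (is @ js) f = partials is (partials js f)"
  by (induction "is") auto

lemma partials_exist_append:
  "partials_exist k (is @ js) f \<longleftrightarrow> partials_exist k js f \<and> partials_exist k is (partials js f)"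
  by (induction "is") (auto simp: partials_append)

lemma indices_Suc_update:
  "indices (Suc p) (\<beta>(Suc p := c)) = indices p \<beta> @ (if c = 1 then [Suc p] else [])"
  by (auto simp: indices_def intro!: filter_cong)

text \<open>
  The last variable is differentiated first, so splitting it off leaves a mixed derivative in the
  remaining variables of a single function.
\<close>

lemma mixed_Suc_update:
  "mixed (Suc p) (\<beta>(Suc p := c)) g = mixed p \<beta> (if c = 1 then partial (Suc p) g else g)"
  by (simp add: mixed_def indices_Suc_update partials_append)

lemma Bset_Suc: "Bset (Suc p) = (\<lambda>(c, \<beta>). \<beta>(Suc p := c)) ` ({0, 1} \<times> Bset p)"
  by (simp add: Bset_def atLeastAtMostSuc_conv PiE_insert_eq)

lemma sum_Bset_Suc:
  "(\<Sum>\<beta>\<in>Bset (Suc p). f \<beta>) = (\<Sum>c\<in>{0, 1}. \<Sum>\<beta>\<in>Bset p. f (\<beta>(Suc p := c)))"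
proof -
  have inj: "inj_on (\<lambda>(c, \<beta>). \<beta>(Suc p := c)) ({0, 1::nat} \<times> Bset p)"
    unfolding Bset_def by (rule inj_combinator) simp
  show ?thesis
    unfolding Bset_Suc sum.reindex[OF inj] sum.cartesian_product
    by (simp add: case_prod_unfold)
qed

text \<open>
  The class is closed under the step of the iteration: every mixed derivative of $\partial_{p+1} g$
  in the first $p$ variables is one of the mixed derivatives of $g$.
\<close>

lemma Gclass_drop_last:
  assumes "g \<in> Gclass k (Suc p)" "c \<in> {0, 1::nat}"
  shows "(if c = 1 then partial (Suc p) g else g) \<in> Gclass k p"
proof -
  let ?h = "if c = 1 then partial (Suc p) g else g"
  have main: "partials_exist k (indices p \<beta>) ?h \<and> bounded (mixed p \<beta> ?h ` cube k)"
    if "\<beta> \<in> Bset p" for \<beta>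
  proof -
    have "\<beta>(Suc p := c) \<in> Bset (Suc p)"
      using that assms(2) by (auto simp: Bset_Suc)
    then have "partials_exist k (indices (Suc p) (\<beta>(Suc p := c))) g"
      "bounded (mixed (Suc p) (\<beta>(Suc p := c)) g ` cube k)"
      using assms(1) by (auto simp: Gclass_def)
    then show ?thesis
      by (simp only: mixed_Suc_update) (auto simp: indices_Suc_update partials_exist_append split: if_splits)
  qed
  \<comment> \<open>The class also asks for a bounded function; this is the case $\beta = 0$ of \<open>main\<close>.\<close>
  have "(\<lambda>i\<in>{1..p}. 0) \<in> Bset p"
    by (auto simp: Bset_def)
  moreover have "indices p (\<lambda>i\<in>{1..p}. 0) = []"
    by (auto simp: indices_def filter_empty_conv)
  ultimately have "bounded (?h ` cube k)"
    using main[of "\<lambda>i\<in>{1..p}. 0"] by (simp add: mixed_def)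
  with main show ?thesis
    by (simp add: Gclass_def)
qed

lemma Gclass_partial:
  assumes "g \<in> Gclass k p" "i \<in> {1..p}"
  shows "partial_exists k i g" "bounded (partial i g ` cube k)"
proof -
  let ?e = "\<lambda>j\<in>{1..p}. if j = i then 1 else 0::nat"
  have "?e \<in> Bset p"
    by (auto simp: Bset_def)
  moreover have "indices p ?e = [i]"
  proof -
    have "indices p ?e = filter (\<lambda>j. j = i) [1..<Suc p]"
      unfolding indices_def by (intro filter_cong) auto
    also have "\<dots> = [i]"
      using assms(2) by (induction p) (auto simp: filter_empty_conv le_Suc_eq)
    finally show ?thesis .
  qed
  ultimately show "partial_exists k i g" "bounded (partial i g ` cube k)"
    using assms(1) by (fastforce simp: Gclass_def mixed_def)+
qed

lemma partial_exists_has_derivative: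
  assumes "partial_exists k i f" "x \<in> cube k" "i \<in> {1..k}" "t \<in> {0..1}"
  shows "((\<lambda>t. f (x(i := t))) has_vector_derivative partial i f (x(i := t))) (at t within {0..1})"
proof -
  have "x(i := t) \<in> cube k"
    using assms fun_upd_in_cube by blast
  with assms(1) have "(\<lambda>s. f ((x(i := t))(i := s))) differentiable (at ((x(i := t)) i) within {0..1})"
    unfolding partial_exists_def by blast
  then show ?thesis
    by (simp add: partial_def vector_derivative_works)
qed

section \<open>Measurability of the mixed derivatives\<close>

text \<open>
  Freezing the variables beyond $p$ at those of $x$ and clamping the first $p$ to the unit interval
  makes a function on the cube a function on all of $\mathbb{R}^{\mathbb{N}}$.  The variables beyond
  $p$ are frozen because the class says nothing on how $g$ depends on them.  On the whole space,
  without a restriction to the cube, Borel measurability for the product topology coincides with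
  measurability for the product $\sigma$-algebra, so that continuity and products are both at hand.
\<close>

definition clamp_slice :: "nat \<Rightarrow> (nat \<Rightarrow> real) \<Rightarrow> (nat \<Rightarrow> real) \<Rightarrow> nat \<Rightarrow> real" where
  "clamp_slice p x w = (\<lambda>i. if i \<in> {1..p} then max 0 (min 1 (w i)) else x i)"

lemma clamp_slice_in_cube: "p \<le> k \<Longrightarrow> x \<in> cube k \<Longrightarrow> clamp_slice p x w \<in> cube k"
  by (auto simp: cube_def clamp_slice_def PiE_iff extensional_def)

lemma merge_eq_clamp_slice:
  assumes "p \<le> k" "x \<in> cube k" "u \<in> cube p"
  shows "merge {1..p} {p+1..k} (u, x) = clamp_slice p x u"
proof
  fix i
  show "merge {1..p} {p+1..k} (u, x) i = clamp_slice p x u i"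
    using assms cube_nth[of u p i]
    by (auto simp: merge_def clamp_slice_def cube_def PiE_iff extensional_def)
qed

definition slice_measurable ::
  "nat \<Rightarrow> (nat \<Rightarrow> real) \<Rightarrow> ((nat \<Rightarrow> real) \<Rightarrow> real) \<Rightarrow> bool" where
  "slice_measurable p x f \<longleftrightarrow>
     (\<lambda>w. f (clamp_slice p x w)) \<in> borel_measurable (\<Pi>\<^sub>M i\<in>UNIV. borel)"

text \<open>
  The derivative is the pointwise limit of difference quotients along a fixed sequence of step
  functions.  The steps must remain in the unit interval, on whose ends the derivative is one-sided;
  they go to the right from the left half and to the left from the right half.
\<close>

lemma slice_measurable_partial:
  assumes f: "slice_measurable p x f" and ex: "partial_exists k i f"
    and i: "i \<in> {1..p}" and "p \<le> k" and x: "x \<in> cube k"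
  shows "slice_measurable p x (partial i f)"
proof -
  define c :: "real \<Rightarrow> real" where "c t = max 0 (min 1 t)" for t
  \<comment> \<open>The shift by 2 keeps the step at most $1/2$.\<close>
  define s :: "nat \<Rightarrow> real \<Rightarrow> real" where
    "s n t = (if t \<le> 1/2 then t + 1 / real (n + 2) else t - 1 / real (n + 2))" for n t
  have c01: "c t \<in> {0..1}" for t
    by (auto simp: c_def)
  have s01: "s n t \<in> {0..1}" if "t \<in> {0..1}" for n t
  proof -
    define e where "e = 1 / real (n + 2)"
    have "e \<le> 1 / 2" "e > 0"
      by (auto simp: e_def field_simps)
    then show ?thesis
      using that unfolding s_def e_def[symmetric] by auto
  qed
  have s_neq: "s n t \<noteq> t" for n t
    by (auto simp: s_def)
  have s_lim: "(\<lambda>n. s n t) \<longlonglongrightarrow> t" for t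
  proof -
    have "(\<lambda>n. 1 / real (n + 2)) \<longlonglongrightarrow> 0"
      using LIMSEQ_ignore_initial_segment[OF lim_1_over_n, of 2] by simp
    from tendsto_add[OF tendsto_const[of t] this] tendsto_diff[OF tendsto_const[of t] this]
    show ?thesis by (cases "t \<le> 1/2") (simp_all add: s_def)
  qed
  let ?M = "\<Pi>\<^sub>M i\<in>(UNIV::nat set). (borel :: real measure)"
  let ?F = "\<lambda>w. f (clamp_slice p x w)"
  define q where
    "q n w = (?F (w(i := s n (c (w i)))) - ?F w) / (s n (c (w i)) - c (w i))" for n w
  have [measurable]: "?F \<in> borel_measurable ?M"
    using f by (simp add: slice_measurable_def)
  have [measurable]: "(\<lambda>w. s n (c (w i))) \<in> borel_measurable ?M" for n
    unfolding s_def c_def by measurable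
  have [measurable]: "(\<lambda>w. c (w i)) \<in> borel_measurable ?M"
    unfolding c_def by measurable
  have [measurable]: "(\<lambda>w. w(i := s n (c (w i)))) \<in> ?M \<rightarrow>\<^sub>M ?M" for n
    by (rule measurable_PiM_single') (auto simp: space_PiM)
  have q_meas: "q n \<in> borel_measurable ?M" for n
    unfolding q_def by measurable
  have q_lim: "(\<lambda>n. q n w) \<longlonglongrightarrow> partial i f (clamp_slice p x w)" for w
  proof -
    let ?y = "clamp_slice p x w"
    have yi: "?y i = c (w i)"
      using i by (simp add: clamp_slice_def c_def)
    have upd: "clamp_slice p x (w(i := t)) = ?y(i := t)" if "t \<in> {0..1}" for t
      using i that by (auto simp: clamp_slice_def fun_eq_iff)
    have "?y \<in> cube k"
      using x \<open>p \<le> k\<close> by (rule clamp_slice_in_cube[rotated])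
    then have "((\<lambda>t. f (?y(i := t))) has_vector_derivative partial i f (?y(i := c (w i))))
        (at (c (w i)) within {0..1})"
      using i \<open>p \<le> k\<close> c01 by (intro partial_exists_has_derivative[OF ex]) auto
    then have "((\<lambda>t. (f (?y(i := t)) - f (?y(i := c (w i)))) / (t - c (w i)))
        \<longlongrightarrow> partial i f (?y(i := c (w i)))) (at (c (w i)) within {0..1})"
      by (simp add: has_real_derivative_iff_has_vector_derivative[symmetric] has_field_derivative_iff)
    moreover have "filterlim (\<lambda>n. s n (c (w i))) (at (c (w i)) within {0..1}) sequentially"
      using s_lim s01[OF c01] s_neq by (auto simp: filterlim_at)
    ultimately have "(\<lambda>n. (f (?y(i := s n (c (w i)))) - f (?y(i := c (w i)))) / (s n (c (w i)) - c (w i)))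
        \<longlonglongrightarrow> partial i f (?y(i := c (w i)))"
      by (rule filterlim_compose)
    moreover have "?y(i := c (w i)) = ?y"
      by (simp flip: yi)
    ultimately show ?thesis
      unfolding q_def upd[OF s01[OF c01]] by (simp only:)
  qed
  show ?thesis
    unfolding slice_measurable_def
    by (rule borel_measurable_LIMSEQ_real[OF q_lim q_meas])
qed

lemma slice_measurable_partials:
  assumes "slice_measurable p x f" "partials_exist k is f" "set is \<subseteq> {1..p}" "p \<le> k" "x \<in> cube k"
  shows "slice_measurable p x (partials is f)"
  using assms by (induction "is") (auto intro!: slice_measurable_partial)

text \<open>
  The variables in \<open>A\<close> are changed one at a time, and the mean value inequality is used for each.
\<close>

lemma coordinatewise_Lipschitz:
  assumes ex: "\<And>j. j \<in> A \<Longrightarrow> partial_exists k j g"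
    and bd: "\<And>j y. j \<in> A \<Longrightarrow> y \<in> cube k \<Longrightarrow> \<bar>partial j g y\<bar> \<le> C"
    and A: "finite A" "A \<subseteq> {1..k}" and yz: "y \<in> cube k" "z \<in> cube k"
  shows "\<bar>g (\<lambda>j. if j \<in> A then z j else y j) - g y\<bar> \<le> C * (\<Sum>j\<in>A. \<bar>z j - y j\<bar>)"
  using A(1) A(2) ex bd
proof (induction A)
  case empty
  then show ?case by simp
next
  case (insert j A)
  let ?v = "\<lambda>i. if i \<in> A then z i else y i"
  have v: "?v \<in> cube k"
    using yz by (auto simp: cube_def PiE_iff extensional_def)
  have j: "j \<in> {1..k}"
    using insert by auto
  have "norm (g (?v(j := z j)) - g (?v(j := y j))) \<le> C * norm (z j - y j)"
  proof (rule field_differentiable_bound[of "{0..1}" "\<lambda>t. g (?v(j := t))"])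
    fix t :: real assume t: "t \<in> {0..1}"
    show "((\<lambda>t. g (?v(j := t))) has_real_derivative partial j g (?v(j := t))) (at t within {0..1})"
      unfolding has_real_derivative_iff_has_vector_derivative
      by (rule partial_exists_has_derivative[OF _ v j t]) (simp add: insert.prems)
    show "norm (partial j g (?v(j := t))) \<le> C"
      using insert.prems(3)[OF insertI1 fun_upd_in_cube[OF v j t]] by (simp only: real_norm_def)
  qed (use cube_nth[OF yz(1) j] cube_nth[OF yz(2) j] in auto)
  moreover have "?v(j := y j) = ?v" "(\<lambda>i. if i \<in> insert j A then z i else y i) = ?v(j := z j)"
    using insert.hyps by auto
  ultimately have "\<bar>g (\<lambda>i. if i \<in> insert j A then z i else y i) - g ?v\<bar> \<le> C * \<bar>z j - y j\<bar>"
    by (simp only: real_norm_def)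
  moreover have "\<bar>g ?v - g y\<bar> \<le> C * (\<Sum>j\<in>A. \<bar>z j - y j\<bar>)"
    using insert by auto
  ultimately show ?case
    using insert.hyps by (simp add: algebra_simps)
qed

text \<open>
  Existence of the partial derivatives alone would only give separate continuity.  Their boundedness
  gives a Lipschitz bound in all of the first $p$ variables together, hence joint continuity.
\<close>

lemma slice_measurable_Gclass:
  assumes g: "g \<in> Gclass k p" and "p \<le> k" and x: "x \<in> cube k"
  shows "slice_measurable p x g"
proof -
  have "\<exists>C. \<forall>j\<in>{1..p}. \<forall>y\<in>cube k. \<bar>partial j g y\<bar> \<le> C"
  proof -
    have "bounded (\<Union>j\<in>{1..p}. partial j g ` cube k)"
      using Gclass_partial[OF g] by (intro bounded_UN) auto
    then obtain C where "\<forall>a\<in>(\<Union>j\<in>{1..p}. partial j g ` cube k). \<bar>a\<bar> \<le> C"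
      unfolding bounded_iff real_norm_def by blast
    then show ?thesis
      by (intro exI[of _ C]) blast
  qed
  then obtain C where C: "\<And>j y. j \<in> {1..p} \<Longrightarrow> y \<in> cube k \<Longrightarrow> \<bar>partial j g y\<bar> \<le> C"
    by blast
  let ?y = "clamp_slice p x"
  have Lip: "\<bar>g (?y w) - g (?y v)\<bar> \<le> C * (\<Sum>j=1..p. \<bar>?y w j - ?y v j\<bar>)" for w v
  proof -
    have "(\<lambda>j. if j \<in> {1..p} then ?y w j else ?y v j) = ?y w"
      by (auto simp: clamp_slice_def)
    then show ?thesis
      using coordinatewise_Lipschitz[of "{1..p}" k g C "?y v" "?y w"]
        Gclass_partial(1)[OF g] C \<open>p \<le> k\<close> clamp_slice_in_cube[OF \<open>p \<le> k\<close> x] by auto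
  qed
  have "continuous_on UNIV (\<lambda>w. g (?y w))"
    unfolding continuous_on_def
  proof (intro ballI)
    fix v :: "nat \<Rightarrow> real"
    have "continuous_on UNIV (\<lambda>w::nat\<Rightarrow>real. C * (\<Sum>j=1..p. \<bar>?y w j - ?y v j\<bar>))"
      unfolding clamp_slice_def
      by (auto intro!: continuous_intros continuous_on_product_coordinates)
    then have "((\<lambda>w. C * (\<Sum>j=1..p. \<bar>?y w j - ?y v j\<bar>))
        \<longlongrightarrow> C * (\<Sum>j=1..p. \<bar>?y v j - ?y v j\<bar>)) (at v)"
      unfolding continuous_on_def by blast
    then have "((\<lambda>w. C * (\<Sum>j=1..p. \<bar>?y w j - ?y v j\<bar>)) \<longlongrightarrow> 0) (at v)"
      by simp
    then have "((\<lambda>w. g (?y w) - g (?y v)) \<longlongrightarrow> 0) (at v)"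
      by (rule Lim_null_comparison[rotated]) (use Lip in auto)
    then show "((\<lambda>w. g (?y w)) \<longlongrightarrow> g (?y v)) (at v)"
      by (simp add: Lim_null[symmetric])
  qed
  then have "(\<lambda>w. g (?y w)) \<in> borel_measurable borel"
    by (rule borel_measurable_continuous_onI)
  then show ?thesis
    unfolding slice_measurable_def
    using measurable_cong_sets[OF sets_PiM_equal_borel refl] by blast
qed

lemma slice_measurable_mixed:
  assumes "g \<in> Gclass k p" "p \<le> k" "x \<in> cube k" "\<beta> \<in> Bset p"
  shows "slice_measurable p x (mixed p \<beta> g)"
  unfolding mixed_def
  using assms slice_measurable_Gclass[OF assms(1-3)]
  by (intro slice_measurable_partials) (auto simp: Gclass_def indices_def)

section \<open>Existence of the integrals\<close>

lemma cube_sets: "cube p \<in> sets (\<Pi>\<^sub>M j\<in>{1..p}. (lborel :: real measure))"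
  unfolding cube_def by (intro sets_PiM_I_finite) auto

text \<open>
  The integrand is Borel and bounded on a set of measure 1, since $|\chi_\beta| \le 1$ on the cube.
\<close>

lemma psi_defined_Gclass:
  assumes g: "g \<in> Gclass k p" and pk: "p \<le> k" and x: "x \<in> cube k" and \<beta>: "\<beta> \<in> Bset p"
  shows "psi_defined k p \<beta> (mixed p \<beta> g) x"
proof -
  interpret product_sigma_finite "\<lambda>_::nat. lborel :: real measure" ..
  let ?M = "\<Pi>\<^sub>M j\<in>{1..p}. (lborel :: real measure)"
  let ?b = "mixed p \<beta> g"
  let ?G = "\<lambda>u. chi p \<beta> u x * ?b (clamp_slice p x u)"
  obtain C where C: "\<And>y. y \<in> cube k \<Longrightarrow> \<bar>?b y\<bar> \<le> C"
    using g \<beta> by (force simp: Gclass_def bounded_iff)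
  \<comment> \<open>Outside \<open>{1..p}\<close> every point of the finite product has the constant value \<open>undefined\<close>,
    which makes the inclusion into the infinite product measurable.\<close>
  have "(\<lambda>u. u) \<in> ?M \<rightarrow>\<^sub>M (\<Pi>\<^sub>M i\<in>UNIV. borel)"
  proof (rule measurable_PiM_single')
    fix i :: nat
    show "(\<lambda>u. u i) \<in> borel_measurable ?M"
    proof (cases "i \<in> {1..p}")
      case True
      then have "(\<lambda>u. u i) \<in> ?M \<rightarrow>\<^sub>M lborel"
        by (rule measurable_component_singleton)
      then show ?thesis by simp
    next
      case False
      then have "(\<lambda>u. u i) \<in> borel_measurable ?M \<longleftrightarrow> (\<lambda>u. undefined :: real) \<in> borel_measurable ?M"
        by (intro measurable_cong) (auto simp: space_PiM PiE_iff extensional_def)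
      then show ?thesis by simp
    qed
  qed (auto simp: space_PiM)
  then have [measurable]: "(\<lambda>u. ?b (clamp_slice p x u)) \<in> borel_measurable ?M"
    using slice_measurable_mixed[OF g pk x \<beta>]
    unfolding slice_measurable_def by (rule measurable_compose)
  have [measurable]: "(\<lambda>u. u j) \<in> borel_measurable ?M" if "j \<in> {1..p}" for j
    using measurable_component_singleton[OF that, of "\<lambda>_. lborel :: real measure"] by simp
  have [measurable]: "(\<lambda>u. chi p \<beta> u x) \<in> borel_measurable ?M"
    unfolding chi_def chi1_def by measurable
  have chi_le: "\<bar>chi p \<beta> u x\<bar> \<le> 1" if "u \<in> cube p" for u
    unfolding chi_def abs_prod
    by (intro prod_le_1) (use cube_nth[OF that] in \<open>auto simp: chi1_def\<close>)
  have "emeasure ?M (cube p) = (\<Prod>i\<in>{1..p}. emeasure lborel {0..1::real})"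
    unfolding cube_def by (intro emeasure_PiM) auto
  then have fin: "emeasure ?M (cube p) < \<infinity>"
    by simp
  have G_int: "integrable ?M (\<lambda>u. indicator (cube p) u *\<^sub>R ?G u)"
  proof (rule integrableI_bounded_set_indicator[where B = C, OF cube_sets _ fin])
    show "?G \<in> borel_measurable ?M"
      by measurable
    show "AE u in ?M. u \<in> cube p \<longrightarrow> norm (?G u) \<le> C"
    proof (intro AE_I2 impI)
      fix u assume u: "u \<in> cube p"
      have "\<bar>chi p \<beta> u x\<bar> * \<bar>?b (clamp_slice p x u)\<bar> \<le> 1 * C"
        using chi_le[OF u] C[OF clamp_slice_in_cube[OF pk x]] by (intro mult_mono) auto
      then show "norm (?G u) \<le> C"
        by (simp add: abs_mult)
    qed
  qed
  have G_eq: "indicator (cube p) u *\<^sub>R ?G u = indicator (cube p) u *\<^sub>R psi_integrand k p \<beta> ?b x u" for u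
    using merge_eq_clamp_slice[OF pk x, of u]
    by (auto simp: psi_integrand_def indicator_def)
  show ?thesis
    using G_int unfolding psi_defined_def set_integrable_def G_eq .
qed

section \<open>The identity in one variable\<close>

text \<open>
  The product rule for $(u-1)f(u)$ takes the place of an integration by parts: this function
  vanishes at 1 and equals $-f(0)$ at 0, and the term $f(0)$ cancels against the one in
  $\int_0^x f' = f(x) - f(0)$.
\<close>

lemma one_variable_representation:
  fixes f f' :: "real \<Rightarrow> real"
  assumes d: "\<And>t. t \<in> {0..1} \<Longrightarrow> (f has_vector_derivative f' t) (at t within {0..1})"
    and f': "set_integrable lborel {0..1} f'"
    and x: "x \<in> {0..1}"
  shows "(LINT u:{0..1}|lborel. chi1 0 u x * f u + chi1 1 u x * f' u) = f x"
proof -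
  let ?a = "\<lambda>u. f u + (u - 1) * f' u"
  have cont: "continuous_on {0..1} f"
    unfolding continuous_on_eq_continuous_within
    by (intro ballI has_vector_derivative_continuous[OF d])
  have f_int: "set_integrable lborel {0..1} f"
    by (rule borel_integrable_atLeastAtMost'[OF cont])
  have m: "set_integrable lborel {0..1} (\<lambda>u. (u - 1) * f' u)"
  proof (rule set_integrable_bound[OF f'])
    show "set_borel_measurable lborel {0..1} (\<lambda>u. (u - 1) * f' u)"
    proof -
      have "(\<lambda>u. indicator {0..1} u *\<^sub>R f' u) \<in> borel_measurable lborel"
        using f' by (auto simp: set_integrable_def)
      then have "(\<lambda>u. (u - 1) * (indicator {0..1} u *\<^sub>R f' u)) \<in> borel_measurable lborel"
        by (intro borel_measurable_times) auto
      then show ?thesis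
        by (simp add: set_borel_measurable_def algebra_simps)
    qed
    show "AE u in lborel. u \<in> {0..1} \<longrightarrow> norm ((u - 1) * f' u) \<le> norm (f' u)"
    proof (intro AE_I2 impI)
      fix u :: real assume "u \<in> {0..1}"
      then have "\<bar>u - 1\<bar> * \<bar>f' u\<bar> \<le> 1 * \<bar>f' u\<bar>"
        by (intro mult_right_mono) auto
      then show "norm ((u - 1) * f' u) \<le> norm (f' u)"
        by (simp add: abs_mult)
    qed
  qed
  have a: "set_integrable lborel {0..1} ?a"
    by (rule set_integral_add(1)[OF f_int m])
  have "(?a has_integral ((1 - 1) * f 1 - (0 - 1) * f 0)) {0..1}"
  proof (rule fundamental_theorem_of_calculus[where f = "\<lambda>u. (u - 1) * f u"])
    fix u :: real assume "u \<in> {0..1}"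
    from d[OF this] have "(f has_real_derivative f' u) (at u within {0..1})"
      by (simp add: has_real_derivative_iff_has_vector_derivative)
    then have "((\<lambda>u. (u - 1) * f u) has_real_derivative ?a u) (at u within {0..1})"
      by (auto intro!: derivative_eq_intros)
    then show "((\<lambda>u. (u - 1) * f u) has_vector_derivative ?a u) (at u within {0..1})"
      by (simp add: has_real_derivative_iff_has_vector_derivative)
  qed simp
  then have A: "(LINT u:{0..1}|lborel. ?a u) = f 0"
    using set_borel_integral_eq_integral(2)[OF a] by (auto dest: integral_unique)
  have b: "set_integrable lborel {0..x} f'"
    by (rule set_integrable_subset[OF f']) (use x in auto)
  have "(f' has_integral (f x - f 0)) {0..x}"
    using x by (intro fundamental_theorem_of_calculus has_vector_derivative_within_subset[OF d]) auto
  then have B: "(LINT u:{0..x}|lborel. f' u) = f x - f 0"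
    using set_borel_integral_eq_integral(2)[OF b] by (auto dest: integral_unique)
  have "(LINT u:{0..1}|lborel. chi1 0 u x * f u + chi1 1 u x * f' u) =
      (LINT u|lborel. indicator {0..1} u *\<^sub>R ?a u + indicator {0..x} u *\<^sub>R f' u)"
    unfolding set_lebesgue_integral_def
    by (intro Bochner_Integration.integral_cong)
      (use x in \<open>auto simp: chi1_def indicator_def algebra_simps\<close>)
  also have "\<dots> = (LINT u:{0..1}|lborel. ?a u) + (LINT u:{0..x}|lborel. f' u)"
    using a b unfolding set_lebesgue_integral_def set_integrable_def by simp
  finally show ?thesis
    using A B by simp
qed

lemma one_variable_Gclass:
  assumes g: "g \<in> Gclass k p" and i: "i \<in> {1..p}" and pk: "p \<le> k" and x: "x \<in> cube k"
  shows "(LINT u:{0..1}|lborel. chi1 0 u (x i) * g (x(i := u)) + chi1 1 u (x i) * partial i g (x(i := u)))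
    = g x"
proof -
  let ?d = "\<lambda>u. partial i g (x(i := u))"
  let ?D = "\<lambda>u. partial i g (clamp_slice p x (x(i := u)))"
  have ik: "i \<in> {1..k}"
    using i pk by auto
  obtain C where C: "\<And>y. y \<in> cube k \<Longrightarrow> \<bar>partial i g y\<bar> \<le> C"
    using Gclass_partial(2)[OF g i] by (force simp: bounded_iff)
  have "slice_measurable p x (partial i g)"
    using slice_measurable_partial[OF slice_measurable_Gclass[OF g pk x] Gclass_partial(1)[OF g i] i pk x] .
  moreover have "(\<lambda>u. x(i := u)) \<in> (lborel :: real measure) \<rightarrow>\<^sub>M (\<Pi>\<^sub>M i\<in>UNIV. borel)"
    by (rule measurable_PiM_single') (auto simp: space_PiM)
  ultimately have D: "?D \<in> borel_measurable lborel"
    unfolding slice_measurable_def by (rule measurable_compose[rotated])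
  have D_int: "integrable lborel (\<lambda>u. indicator {0..1} u *\<^sub>R ?D u)"
    by (rule integrableI_bounded_set_indicator[where B = C])
      (use D C[OF clamp_slice_in_cube[OF pk x]] in auto)
  have D_eq: "indicator {0..1} u *\<^sub>R ?D u = indicator {0..1} u *\<^sub>R ?d u" for u
  proof (cases "u \<in> {0..1}")
    case True
    have "clamp_slice p x (x(i := u)) = x(i := u)"
      using i pk True cube_nth[OF x] by (auto simp: clamp_slice_def fun_eq_iff)
    then show ?thesis by simp
  qed auto
  have d: "set_integrable lborel {0..1} ?d"
    using D_int unfolding set_integrable_def D_eq .
  have "(LINT u:{0..1}|lborel. chi1 0 u (x i) * g (x(i := u)) + chi1 1 u (x i) * ?d u)
      = g (x(i := x i))"
    using cube_nth[OF x ik]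
    by (intro one_variable_representation[OF _ d] partial_exists_has_derivative[OF Gclass_partial(1)[OF g i] x ik])
      auto
  then show ?thesis by simp
qed

section \<open>Iteration over the variables\<close>

text \<open>
  Fubini's theorem with the inserted variable integrated last.  The iteration needs this order,
  because the expansion of $g$ in the last variable is the outermost one.
\<close>

lemma (in product_sigma_finite) product_integral_insert_outer:
  fixes f :: "_ \<Rightarrow> _::{banach, second_countable_topology}"
  assumes I: "finite I" "i \<notin> I" and f: "integrable (Pi\<^sub>M (insert i I) M) f"
  shows "integral\<^sup>L (Pi\<^sub>M (insert i I) M) f = (\<integral>u. (\<integral>y. f (y(i := u)) \<partial>Pi\<^sub>M I M) \<partial>M i)"
proof -
  interpret I: finite_product_sigma_finite M I by standard fact
  have [measurable]: "f \<in> borel_measurable (Pi\<^sub>M (insert i I) M)"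
    using f by auto
  have "(\<lambda>(u, y). f (y(i := u))) \<in> borel_measurable (M i \<Otimes>\<^sub>M Pi\<^sub>M I M)"
  proof -
    have "(\<lambda>(u, y). y(i := u)) \<in> M i \<Otimes>\<^sub>M Pi\<^sub>M I M \<rightarrow>\<^sub>M Pi\<^sub>M (insert i I) M"
      using measurable_compose[OF measurable_pair_swap' measurable_add_dim[of i I M]]
      by (simp add: case_prod_unfold)
    from measurable_compose[OF this, of f borel] show ?thesis
      by (simp add: case_prod_unfold)
  qed
  then have meas: "(\<lambda>u. \<integral>y. f (y(i := u)) \<partial>Pi\<^sub>M I M) \<in> borel_measurable (M i)"
    by (rule I.borel_measurable_lebesgue_integral)
  have "integral\<^sup>L (Pi\<^sub>M (insert i I) M) f
      = (\<integral>x. (\<integral>y. f (merge {i} I (x, y)) \<partial>Pi\<^sub>M I M) \<partial>Pi\<^sub>M {i} M)"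
    using product_integral_fold[of "{i}" I f] I f by simp
  also have "\<dots> = (\<integral>x. (\<integral>y. f (y(i := x i)) \<partial>Pi\<^sub>M I M) \<partial>Pi\<^sub>M {i} M)"
  proof (intro Bochner_Integration.integral_cong refl)
    fix x y assume "y \<in> space (Pi\<^sub>M I M)"
    then have "merge {i} I (x, y) = y(i := x i)"
      using I(2) by (auto simp: merge_def space_PiM PiE_iff extensional_def fun_eq_iff)
    then show "f (merge {i} I (x, y)) = f (y(i := x i))"
      by simp
  qed
  also have "\<dots> = (\<integral>u. (\<integral>y. f (y(i := u)) \<partial>Pi\<^sub>M I M) \<partial>M i)"
    by (rule product_integral_singleton[OF meas])
  finally show ?thesis .
qed

text \<open>
  The kernel is a product over the variables, so its last factor comes out.  What remains is the
  integrand for $p$ variables, in which the variable $p+1$ is one of the frozen ones.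
\<close>

lemma psi_integrand_Suc:
  assumes "Suc p \<le> k"
  shows "psi_integrand k (Suc p) (\<beta>(Suc p := c)) b x (v(Suc p := u))
    = chi1 c u (x (Suc p)) * psi_integrand k p \<beta> b (x(Suc p := u)) v"
proof -
  have "chi (Suc p) (\<beta>(Suc p := c)) (v(Suc p := u)) x
      = chi1 c u (x (Suc p)) * chi p \<beta> v (x(Suc p := u))"
    by (simp add: chi_def mult.commute)
  moreover have "merge {1..Suc p} {Suc p+1..k} (v(Suc p := u), x)
      = merge {1..p} {p+1..k} (v, x(Suc p := u))"
    using assms by (auto simp: merge_def fun_eq_iff)
  ultimately show ?thesis
    by (simp only: psi_integrand_def mult.assoc)
qed

lemma fun_upd_in_cube_Suc:
  assumes "v \<in> extensional {1..p}"
  shows "v(Suc p := u) \<in> cube (Suc p) \<longleftrightarrow> v \<in> cube p \<and> u \<in> {0..1}"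
  using assms by (auto simp: cube_def PiE_iff extensional_def le_Suc_eq Ball_def)

text \<open>
  The iteration starts at $p = 0$, where the cube is one point of mass 1 and the identity is trivial.
\<close>

lemma sum_psi_mixed:
  assumes "g \<in> Gclass k p" "p \<le> k" "x \<in> cube k"
  shows "(\<Sum>\<beta>\<in>Bset p. psi k p \<beta> (mixed p \<beta> g) x) = g x"
  using assms
proof (induction p arbitrary: g x)
  case 0
  have "merge {1..0} {0+1..k} (u, x) = x" for u
    using \<open>x \<in> cube k\<close> by (auto simp: merge_def cube_def PiE_iff extensional_def fun_eq_iff)
  then show ?case
    by (simp add: Bset_def psi_def psi_integrand_def chi_def mixed_def indices_def cube_def
        set_lebesgue_integral_def PiM_empty lebesgue_integral_count_space_finite)
next
  case (Suc p)
  interpret product_sigma_finite "\<lambda>_::nat. lborel :: real measure" ..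
  let ?n = "Suc p"
  let ?L = "\<lambda>m. \<Pi>\<^sub>M j\<in>{1..m}. (lborel :: real measure)"
  let ?I = "\<lambda>\<beta> u. indicator (cube ?n) u *\<^sub>R psi_integrand k ?n \<beta> (mixed ?n \<beta> g) x u"
  define h where "h c = (if c = 1 then partial ?n g else g)" for c :: nat
  let ?J = "\<lambda>c \<beta> u v. indicator (cube p) v *\<^sub>R psi_integrand k p \<beta> (mixed p \<beta> (h c)) (x(?n := u)) v"
  have pk: "p \<le> k" and n: "?n \<in> {1..k}"
    using Suc.prems by auto
  have int: "integrable (?L ?n) (?I \<beta>)" if "\<beta> \<in> Bset ?n" for \<beta>
    using psi_defined_Gclass[OF Suc.prems that] by (simp add: psi_defined_def set_integrable_def)
  have hG: "h c \<in> Gclass k p" if "c \<in> {0, 1}" for c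
    unfolding h_def by (rule Gclass_drop_last[OF Suc.prems(1) that])
  \<comment> \<open>Integrating the whole sum over the first $p$ variables, rather than its terms, gives an integrand
    in the last variable that is known explicitly from the induction hypothesis.\<close>
  have slice: "(\<integral>v. (\<Sum>\<beta>\<in>Bset ?n. ?I \<beta> (v(?n := u))) \<partial>?L p)
      = indicator {0..1} u *\<^sub>R (chi1 0 u (x ?n) * g (x(?n := u)) + chi1 1 u (x ?n) * partial ?n g (x(?n := u)))"
    for u
  proof (cases "u \<in> {0..1}")
    case False
    then have "(\<integral>v. (\<Sum>\<beta>\<in>Bset ?n. ?I \<beta> (v(?n := u))) \<partial>?L p) = (\<integral>v. 0 \<partial>?L p)"
      by (intro Bochner_Integration.integral_cong refl sum.neutral)
        (auto simp: space_PiM PiE_iff fun_upd_in_cube_Suc indicator_def)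
    with False show ?thesis by simp
  next
    case True
    have y: "x(?n := u) \<in> cube k"
      using fun_upd_in_cube[OF Suc.prems(3) n True] .
    have J: "integrable (?L p) (?J c \<beta> u)" if "c \<in> {0, 1}" "\<beta> \<in> Bset p" for c \<beta>
      using psi_defined_Gclass[OF hG[OF that(1)] pk y that(2)]
      by (simp add: psi_defined_def set_integrable_def)
    have "(\<integral>v. (\<Sum>\<beta>\<in>Bset ?n. ?I \<beta> (v(?n := u))) \<partial>?L p)
        = (\<integral>v. (\<Sum>c\<in>{0, 1}. \<Sum>\<beta>\<in>Bset p. chi1 c u (x ?n) * ?J c \<beta> u v) \<partial>?L p)"
    proof (intro Bochner_Integration.integral_cong refl)
      fix v assume "v \<in> space (?L p)"
      then have v: "v \<in> extensional {1..p}"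
        by (auto simp: space_PiM PiE_iff)
      show "(\<Sum>\<beta>\<in>Bset ?n. ?I \<beta> (v(?n := u)))
          = (\<Sum>c\<in>{0, 1}. \<Sum>\<beta>\<in>Bset p. chi1 c u (x ?n) * ?J c \<beta> u v)"
        unfolding sum_Bset_Suc
        by (intro sum.cong refl, simp only: mixed_Suc_update psi_integrand_Suc[OF Suc.prems(2)] h_def)
          (use True fun_upd_in_cube_Suc[OF v, of u] in \<open>auto simp: indicator_def\<close>)
    qed
    also have "\<dots> = (\<Sum>c\<in>{0, 1}. \<Sum>\<beta>\<in>Bset p. chi1 c u (x ?n) * (\<integral>v. ?J c \<beta> u v \<partial>?L p))"
    proof -
      have "(\<integral>v. (\<Sum>\<beta>\<in>Bset p. chi1 c u (x ?n) * ?J c \<beta> u v) \<partial>?L p)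
          = (\<Sum>\<beta>\<in>Bset p. chi1 c u (x ?n) * (\<integral>v. ?J c \<beta> u v \<partial>?L p))" if "c \<in> {0, 1}" for c
        using J[OF that] by (subst Bochner_Integration.integral_sum) auto
      moreover have "integrable (?L p) (\<lambda>v. \<Sum>\<beta>\<in>Bset p. chi1 c u (x ?n) * ?J c \<beta> u v)"
        if "c \<in> {0, 1}" for c
        using J[OF that] by (intro Bochner_Integration.integrable_sum integrable_mult_right)
      ultimately show ?thesis
        by (subst Bochner_Integration.integral_sum) (simp_all only: cong: sum.cong)
    qed
    also have "\<dots> = (\<Sum>c\<in>{0, 1}. chi1 c u (x ?n) * (\<Sum>\<beta>\<in>Bset p. psi k p \<beta> (mixed p \<beta> (h c)) (x(?n := u))))"
      by (simp add: psi_def set_lebesgue_integral_def sum_distrib_left)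
    also have "\<dots> = (\<Sum>c\<in>{0, 1}. chi1 c u (x ?n) * h c (x(?n := u)))"
      by (intro sum.cong refl arg_cong2[where f = times] Suc.IH[OF hG pk y])
    finally show ?thesis
      using True by (simp add: h_def)
  qed
  have sum_int: "integrable (?L ?n) (\<lambda>w. \<Sum>\<beta>\<in>Bset ?n. ?I \<beta> w)"
    by (intro Bochner_Integration.integrable_sum int)
  have ins: "{1..?n} = insert ?n {1..p}"
    by auto
  have "(\<Sum>\<beta>\<in>Bset ?n. psi k ?n \<beta> (mixed ?n \<beta> g) x) = (\<integral>w. (\<Sum>\<beta>\<in>Bset ?n. ?I \<beta> w) \<partial>?L ?n)"
    unfolding psi_def set_lebesgue_integral_def
    by (rule Bochner_Integration.integral_sum[symmetric]) (rule int)
  also have "\<dots> = (\<integral>u. (\<integral>v. (\<Sum>\<beta>\<in>Bset ?n. ?I \<beta> (v(?n := u))) \<partial>?L p) \<partial>lborel)"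
    unfolding ins
    by (rule product_integral_insert_outer[OF _ _ sum_int[unfolded ins]]) auto
  also have "\<dots> = g x"
    using one_variable_Gclass[OF Suc.prems(1) _ Suc.prems(2,3), of ?n]
    unfolding slice set_lebesgue_integral_def by simp
  finally show ?case .
qed

theorem corollary1:
  fixes k p :: nat and g :: "(nat \<Rightarrow> real) \<Rightarrow> real"
  assumes "1 \<le> p" and "p \<le> k" and "g \<in> Gclass k p"
  shows "\<forall>x\<in>cube k.
    (\<forall>\<beta>\<in>Bset p. psi_defined k p \<beta> (mixed p \<beta> g) x) \<and>
    g x = (\<Sum>\<beta>\<in>Bset p. psi k p \<beta> (mixed p \<beta> g) x)"
  using psi_defined_Gclass[OF assms(3,2)] sum_psi_mixed[OF assms(3,2)] by simp

end
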